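(* Let $\mathcal{X},\mathcal{Y}$ be finite sets and $\{p(x,y|\theta)\mid\theta\in\Theta\}$ a model on $\mathcal{X}\times\mathcal{Y}$ as in the context, so that $\Theta$ is compact and for every $x\in\mathcal{X}$ there is $\theta\in\Theta$ with $p(x|\theta)>0$. 1) There exists a convergent prior sequence $\{\pi_n\}_{n=1}^\infty$ in $\mathcal{P}$ (with $p_{\pi_n}(x)>0$ for every $n$ and every $x\in\mathcal{X}$) such that $\lim_{n\to\infty}p_{\pi_n}(y|x)$ exists and is a minimax predictive density, and the equality $$I_{\theta,y|x}(\pi_\infty)=\sup_{\pi\in\mathcal{P}}I_{\theta,y|x}(\pi)$$ holds, where $\pi_\infty=\lim_{n\to\infty}\pi_n$. 2) Let $\hat\pi\in\mathcal{P}$ be a prior maximizing $I_{\theta,y|x}(\pi)$ over $\pi\in\mathcal{P}$. If $p_{\hat\pi}(x)>0$ for all $x\in\mathcal{X}$, then $p_{\hat\pi}(y|x)$ is a minimax predictive density.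
   Context: Setting. $\mathcal{X}$ and $\mathcal{Y}$ are finite sets with $k$ and $l$ elements. $\{p(x,y|\theta)\mid\theta\in\Theta\}$ is a set of probability densities (mass functions) on $\mathcal{X}\times\mathcal{Y}$; $\Theta$ is identified with this set, i.e. with a subset of the probability simplex in $\mathbb{R}^{kl}$, and carries the induced Euclidean topology (so $\theta\mapsto p(x,y|\theta)$ is continuous for each $(x,y)$). Write $p(x|\theta)=\sum_{y}p(x,y|\theta)$ and $p(y|x,\theta)=p(x,y|\theta)/p(x|\theta)$ when $p(x|\theta)>0$. Standing assumptions: (1) $\Theta$ is compact; (2) for every $x\in\mathcal{X}$ there exists $\theta\in\Theta$ with $p(x|\theta)>0$. Priors. $\mathcal{P}$ is the set of all (Borel) probability measures on $\Theta$ with the topology of weak convergence; a convergent prior sequence is a sequence converging in $\mathcal{P}$. For $\pi\in\mathcal{P}$, $p_\pi(x,y)=\int p(x,y|\theta)\,d\pi(\theta)$, $p_\pi(x)=\int p(x|\theta)\,d\pi(\theta)$, and $p_\pi(y|x)=p_\pi(x,y)/p_\pi(x)$ when $p_\pi(x)>0$. A predictive density is a function $q(y;x)$ from $\mathcal{X}\times\mathcal{Y}$ to $[0,1]$ with $\sum_{y\in\mathcal{Y}}q(y;x)=1$ for every $x\in\mathcal{X}$. It is minimax if $$\sup_{\theta\in\Theta}\sum_{x,y}p(x,y|\theta)\log\frac{p(y|x,\theta)}{q(y;x)}=\inf_{\bar q}\sup_{\theta\in\Theta}\sum_{x,y}p(x,y|\theta)\log\frac{p(y|x,\theta)}{\bar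 q(y;x)},$$ the infimum being over all predictive densities $\bar q$. Conventions: $c\log 0=-\infty$ for $c>0$, $0\log 0=0$, $0\log(c/0)=0$ for $c\ge 0$; terms with $p(x,y|\theta)=0$ are $0$ (so the choice of $p(y|x,\theta)$ when $p(x|\theta)=0$ is irrelevant), and a term with $p(x,y|\theta)>0$ and zero predictive density equals $+\infty$. The conditional mutual information between $y$ and $\theta$ given $x$ is the function of $\pi\in\mathcal{P}$ $$I_{\theta,y|x}(\pi)=\int\sum_{x,y}p(x,y|\theta)\log p(x,y|\theta)\,d\pi(\theta)-\sum_{x,y}p_\pi(x,y)\log p_\pi(x,y)-\int\sum_x p(x|\theta)\log p(x|\theta)\,d\pi(\theta)+\sum_x p_\pi(x)\log p_\pi(x).$$ Limits of Bayesian predictive densities: for a sequence of priors $\{\pi_n\}$ with $p_{\pi_n}(x)>0$ for every $n$ and every $x\in\mathcal{X}$, $\lim_{n\to\infty}p_{\pi_n}(y|x)$ denotes the map sending $(x,y)$ to the limit of the real sequence $\{p_{\pi_n}(y|x)\}_{n}$; it is said to exist if these limits exist for all $(x,y)\in\mathcal{X}\times\mathcal{Y}$, and it is then a predictive density. *)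

theory Defs
  imports "HOL-Probability.Probability"
begin

text \<open>
  A model on \<open>'x \<times> 'y\<close> is a set \<open>\<Theta>\<close> of vectors in \<open>real ^ ('x \<times> 'y)\<close>: the parameter \<open>\<theta>\<close>
  is identified with the mass function \<open>(x, y) \<mapsto> p(x, y | \<theta>) = \<theta> $ (x, y)\<close>.
\<close>

definition prob_simplex :: "(real ^ 'n::finite) set" where
  "prob_simplex = {\<theta>. (\<forall>i. 0 \<le> \<theta> $ i) \<and> (\<Sum>i\<in>UNIV. \<theta> $ i) = 1}"

definition joint :: "real ^ ('x::finite \<times> 'y::finite) \<Rightarrow> 'x \<Rightarrow> 'y \<Rightarrow> real" where
  "joint \<theta> x y = \<theta> $ (x, y)"

definition marginal :: "real ^ ('x::finite \<times> 'y::finite) \<Rightarrow> 'x \<Rightarrow> real" where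
  "marginal \<theta> x = (\<Sum>y\<in>UNIV. joint \<theta> x y)"

text \<open>The value for \<open>marginal \<theta> x = 0\<close> is irrelevant: it is never used in \<open>kl_term\<close>.\<close>

definition conditional :: "real ^ ('x::finite \<times> 'y::finite) \<Rightarrow> 'x \<Rightarrow> 'y \<Rightarrow> real" where
  "conditional \<theta> x y = joint \<theta> x y / marginal \<theta> x"

definition priors :: "'a::topological_space set \<Rightarrow> 'a measure set" where
  "priors \<Theta> = {\<pi>. prob_space \<pi> \<and> sets \<pi> = sets (restrict_space borel \<Theta>)}"

text \<open>
  Weak convergence of measures on the subspace \<open>\<Theta>\<close>; the library's \<open>weak_conv_m\<close> covers only
  measures on the real line.
\<close>

definition weakly_converges ::
  "'a::topological_space set \<Rightarrow> (nat \<Rightarrow> 'a measure) \<Rightarrow> 'a measure \<Rightarrow> bool" where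
  "weakly_converges \<Theta> \<pi>s \<pi> \<longleftrightarrow>
     (\<forall>f :: 'a \<Rightarrow> real. continuous_on \<Theta> f \<and> bounded (f ` \<Theta>) \<longrightarrow>
        (\<lambda>n. \<integral>\<theta>. f \<theta> \<partial>\<pi>s n) \<longlonglongrightarrow> (\<integral>\<theta>. f \<theta> \<partial>\<pi>))"

definition mix_joint ::
  "(real ^ ('x::finite \<times> 'y::finite)) measure \<Rightarrow> 'x \<Rightarrow> 'y \<Rightarrow> real" where
  "mix_joint \<pi> x y = (\<integral>\<theta>. joint \<theta> x y \<partial>\<pi>)"

definition mix_marginal ::
  "(real ^ ('x::finite \<times> 'y::finite)) measure \<Rightarrow> 'x \<Rightarrow> real" where
  "mix_marginal \<pi> x = (\<integral>\<theta>. marginal \<theta> x \<partial>\<pi>)"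

definition bayes_predictive ::
  "(real ^ ('x::finite \<times> 'y::finite)) measure \<Rightarrow> 'x \<Rightarrow> 'y \<Rightarrow> real" where
  "bayes_predictive \<pi> x y = mix_joint \<pi> x y / mix_marginal \<pi> x"

text \<open>Predictive densities are written with \<open>q x y\<close> for \<open>q(y; x)\<close>.\<close>

definition predictive_density :: "('x::finite \<Rightarrow> 'y::finite \<Rightarrow> real) \<Rightarrow> bool" where
  "predictive_density q \<longleftrightarrow>
     (\<forall>x y. q x y \<in> {0..1}) \<and> (\<forall>x. (\<Sum>y\<in>UNIV. q x y) = 1)"

text \<open>
  The summand \<open>p(x, y | \<theta>) log (p(y | x, \<theta>) / q(y; x))\<close>, with the conventions
  \<open>0 log (c / 0) = 0 log 0 = 0\<close> and \<open>c log (d / 0) = \<infinity>\<close> for \<open>c, d > 0\<close>.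
\<close>

definition kl_term ::
  "('x::finite \<Rightarrow> 'y::finite \<Rightarrow> real) \<Rightarrow> real ^ ('x \<times> 'y) \<Rightarrow> 'x \<Rightarrow> 'y \<Rightarrow> ereal" where
  "kl_term q \<theta> x y =
     (if joint \<theta> x y = 0 then 0
      else if q x y = 0 then \<infinity>
      else ereal (joint \<theta> x y * ln (conditional \<theta> x y / q x y)))"

definition kl_risk ::
  "('x::finite \<Rightarrow> 'y::finite \<Rightarrow> real) \<Rightarrow> real ^ ('x \<times> 'y) \<Rightarrow> ereal" where
  "kl_risk q \<theta> = (\<Sum>x\<in>UNIV. \<Sum>y\<in>UNIV. kl_term q \<theta> x y)"

definition minimax ::
  "(real ^ ('x::finite \<times> 'y::finite)) set \<Rightarrow> ('x \<Rightarrow> 'y \<Rightarrow> real) \<Rightarrow> bool" where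
  "minimax \<Theta> q \<longleftrightarrow> predictive_density q \<and>
     (SUP \<theta>\<in>\<Theta>. kl_risk q \<theta>) = (INF q'\<in>Collect predictive_density. SUP \<theta>\<in>\<Theta>. kl_risk q' \<theta>)"

text \<open>The convention \<open>0 log 0 = 0\<close> needs no case distinction in \<open>t * ln t\<close>.\<close>

definition cond_mutual_info :: "(real ^ ('x::finite \<times> 'y::finite)) measure \<Rightarrow> real" where
  "cond_mutual_info \<pi> =
     (\<integral>\<theta>. (\<Sum>x\<in>UNIV. \<Sum>y\<in>UNIV. joint \<theta> x y * ln (joint \<theta> x y)) \<partial>\<pi>)
     - (\<Sum>x\<in>UNIV. \<Sum>y\<in>UNIV. mix_joint \<pi> x y * ln (mix_joint \<pi> x y))
     - (\<integral>\<theta>. (\<Sum>x\<in>UNIV. marginal \<theta> x * ln (marginal \<theta> x)) \<partial>\<pi>)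
     + (\<Sum>x\<in>UNIV. mix_marginal \<pi> x * ln (mix_marginal \<pi> x))"

end

theory Submission
  imports Defs "HOL-Real_Asymp.Real_Asymp"
begin

text \<open>
  Write \<open>H m\<close> for the conditional entropy of \<open>y\<close> given \<open>x\<close> under \<open>m\<close>. The conditional mutual
  information of a prior \<open>\<pi>\<close> is \<open>H (barycentre \<pi>) - \<integral>H d\<pi>\<close>, and the risk of \<open>q\<close> at \<open>\<theta>\<close> is
  \<open>cross_entropy q \<theta> - H \<theta>\<close> (or \<open>\<infinity>\<close>), with the cross entropy linear in \<open>\<theta>\<close>. So everything
  depends on \<open>\<pi>\<close> only through its moments \<open>(barycentre \<pi>, \<integral>H d\<pi>)\<close>, and every point of the compact
  convex hull of the graph of \<open>H\<close> over \<open>\<Theta>\<close> arises as the moments of a prior.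

  The theorem is a saddle-point statement. By the Gibbs inequality, the risk of any \<open>q\<close> averaged
  over \<open>\<pi>\<close> is at least the information of \<open>\<pi>\<close>. Hence if some \<open>q\<close> has risk at most the information
  of \<open>\<pi>\<close> at every \<open>\<theta>\<close>, then \<open>q\<close> is minimax and \<open>\<pi>\<close> maximises the information
  (\<open>minimax_if_risk_le_information\<close>, \<open>cond_mutual_info_le\<close>). For a maximiser \<open>\<pi>\<close> with positive
  marginals the required risk bound is the first-order condition
  (\<open>maximality_bounds_cross_entropy\<close>), which settles the second claim.

  For the first claim, the information is maximised over copies of the hull shrunk slightly towards
  a point with positive marginals. The first-order condition then holds up to an
  error that disappears in the limit, and semicontinuity of the cross entropy carries it over to a
  limit \<open>q\<close> of the conditionals and a limit \<open>c\<close> of the moments (\<open>limiting_maximizer\<close>). To obtain a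
  weakly convergent sequence of priors, a prior \<open>\<pi>\<close> with moments \<open>c\<close> is fixed and mixed with a
  vanishing proportion of priors realising the approximating moments: where the marginal of \<open>\<pi>\<close>
  vanishes the conditional is decided by the admixture alone, and elsewhere by \<open>\<pi>\<close>
  (\<open>conditional_mix_limit\<close>).
\<close>

section \<open>Conditional entropy and cross entropy\<close>

definition nonneg_vec :: "real ^ 'n \<Rightarrow> bool" where
  "nonneg_vec m \<longleftrightarrow> (\<forall>i. 0 \<le> m $ i)"

text \<open>The entropy \<open>H(Y | X)\<close>, extended from mass functions to arbitrary vectors by the same formula, so
that it can be applied to \<open>\<theta>\<close> and to barycentres alike.\<close>

definition cond_entropy :: "real ^ ('x::finite \<times> 'y::finite) \<Rightarrow> real" where
  "cond_entropy m = (\<Sum>x\<in>UNIV. marginal m x * ln (marginal m x))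
     - (\<Sum>x\<in>UNIV. \<Sum>y\<in>UNIV. joint m x y * ln (joint m x y))"

definition cross_entropy ::
  "('x::finite \<Rightarrow> 'y::finite \<Rightarrow> real) \<Rightarrow> real ^ ('x \<times> 'y) \<Rightarrow> real" where
  "cross_entropy q m = - (\<Sum>x\<in>UNIV. \<Sum>y\<in>UNIV. joint m x y * ln (q x y))"

text \<open>Exactly the condition under which the convention \<open>0 log 0 = 0\<close>, which the value \<open>ln 0 = 0\<close>
implements, makes \<open>cross_entropy q m\<close> the true cross entropy; otherwise the true value is \<open>\<infinity>\<close>.\<close>

definition dominates ::
  "('x::finite \<Rightarrow> 'y::finite \<Rightarrow> real) \<Rightarrow> real ^ ('x \<times> 'y) \<Rightarrow> bool" where
  "dominates q m \<longleftrightarrow> (\<forall>x y. 0 < joint m x y \<longrightarrow> 0 < q x y)"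

lemma joint_nonneg: "nonneg_vec m \<Longrightarrow> 0 \<le> joint m x y"
  by (simp add: nonneg_vec_def joint_def)

lemma joint_le_marginal: "nonneg_vec m \<Longrightarrow> joint m x y \<le> marginal m x"
  unfolding marginal_def by (rule member_le_sum) (auto simp: joint_nonneg)

lemma marginal_nonneg: "nonneg_vec m \<Longrightarrow> 0 \<le> marginal m x"
  by (simp add: marginal_def sum_nonneg joint_nonneg)

lemma joint_mix: "joint ((1 - u) *\<^sub>R m + u *\<^sub>R m') x y = (1 - u) * joint m x y + u * joint m' x y"
  by (simp add: joint_def)

lemma marginal_mix:
  "marginal ((1 - u) *\<^sub>R m + u *\<^sub>R m') x = (1 - u) * marginal m x + u * marginal m' x"
  by (simp add: marginal_def joint_mix sum.distrib sum_distrib_left)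

lemma cross_entropy_mix:
  "cross_entropy q ((1 - u) *\<^sub>R m + u *\<^sub>R m')
     = (1 - u) * cross_entropy q m + u * cross_entropy q m'"
  unfolding cross_entropy_def joint_mix
  by (simp add: distrib_right sum.distrib mult.assoc flip: sum_distrib_left)

lemma nonneg_vec_mix:
  assumes "nonneg_vec m" "nonneg_vec m'" "0 \<le> u" "u \<le> 1"
  shows "nonneg_vec ((1 - u) *\<^sub>R m + u *\<^sub>R m')"
  using assms by (simp add: nonneg_vec_def)

lemma continuous_on_joint [continuous_intros]: "continuous_on S (\<lambda>m. joint m x y)"
  unfolding joint_def by (intro continuous_intros)

lemma continuous_on_marginal [continuous_intros]: "continuous_on S (\<lambda>m. marginal m x)"
  unfolding marginal_def by (intro continuous_intros)

lemma tendsto_joint: "(f \<longlongrightarrow> m) F \<Longrightarrow> ((\<lambda>n. joint (f n) x y) \<longlongrightarrow> joint m x y) F"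
  unfolding joint_def by (rule tendsto_vec_nth)

lemma tendsto_marginal: "(f \<longlongrightarrow> m) F \<Longrightarrow> ((\<lambda>n. marginal (f n) x) \<longlongrightarrow> marginal m x) F"
  unfolding marginal_def by (intro tendsto_sum tendsto_joint)

lemma tendsto_conditional:
  assumes "(f \<longlongrightarrow> m) F" "marginal m x \<noteq> 0"
  shows "((\<lambda>n. conditional (f n) x y) \<longlongrightarrow> conditional m x y) F"
  unfolding conditional_def using assms by (intro tendsto_divide tendsto_joint tendsto_marginal)

text \<open>The left half of the line follows from the right half because \<open>ln (-t) = ln t\<close>.\<close>

lemma continuous_x_ln_x: "continuous_on UNIV (\<lambda>t::real. t * ln t)"
proof -
  have 0: "((\<lambda>t::real. t * ln t) \<longlongrightarrow> 0) (at_right 0)"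
    by real_asymp
  have "((\<lambda>t::real. t * ln t) \<longlongrightarrow> 0) (at_left 0)"
    unfolding filterlim_at_left_to_right using tendsto_minus[OF 0] by (simp add: ln_minus)
  with 0 have "((\<lambda>t::real. t * ln t) \<longlongrightarrow> 0) (at 0)"
    by (simp add: filterlim_split_at)
  then have "isCont (\<lambda>t::real. t * ln t) t" for t
    by (cases "t = 0") (auto simp: isCont_def intro!: tendsto_eq_intros)
  then show ?thesis
    by (simp add: continuous_on_eq_continuous_at)
qed

lemma continuous_on_cond_entropy [continuous_intros]: "continuous_on S cond_entropy"
proof -
  note c = continuous_on_compose2[OF continuous_x_ln_x _ subset_UNIV]
  show ?thesis
    unfolding cond_entropy_def by (intro continuous_intros c)
qed

lemma tendsto_cond_entropy:
  "(f \<longlongrightarrow> m) F \<Longrightarrow> ((\<lambda>n. cond_entropy (f n)) \<longlongrightarrow> cond_entropy m) F"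
  using continuous_on_tendsto_compose[OF continuous_on_cond_entropy[of UNIV]] by auto

lemma cond_entropy_eq_cross_entropy:
  assumes "nonneg_vec m"
  shows "cond_entropy m = cross_entropy (conditional m) m"
proof -
  have "joint m x y * ln (conditional m x y)
      = joint m x y * ln (joint m x y) - joint m x y * ln (marginal m x)" for x y
  proof (cases "joint m x y = 0")
    case False
    then have "0 < joint m x y" "0 < marginal m x"
      using joint_nonneg[OF assms, of x y] joint_le_marginal[OF assms, of x y] by linarith+
    then show ?thesis
      by (simp add: conditional_def ln_div algebra_simps)
  qed simp
  then show ?thesis
    by (simp add: cond_entropy_def cross_entropy_def sum_subtractf marginal_def
        flip: sum_distrib_right)
qed

lemma conditional_range: "nonneg_vec m \<Longrightarrow> conditional m x y \<in> {0..1}"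
  using joint_nonneg[of m x y] joint_le_marginal[of m x y] marginal_nonneg[of m x]
  by (auto simp: conditional_def divide_le_eq_1)

lemma sum_conditional: "marginal m x \<noteq> 0 \<Longrightarrow> (\<Sum>y\<in>UNIV. conditional m x y) = 1"
  by (simp add: conditional_def marginal_def flip: sum_divide_distrib)

lemma dominates_conditional: "nonneg_vec m \<Longrightarrow> dominates (conditional m) m"
  unfolding dominates_def conditional_def
  using joint_le_marginal by (metis divide_pos_pos less_le_trans)

lemma predictive_density_conditional:
  "nonneg_vec m \<Longrightarrow> (\<And>x. 0 < marginal m x) \<Longrightarrow> predictive_density (conditional m)"
  unfolding predictive_density_def using conditional_range sum_conditional
  by (metis less_irrefl)

text \<open>Summand by summand this is \<open>ln t \<le> t - 1\<close>; the resulting upper bounds sum to \<open>0\<close> because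
both \<open>q\<close> and the conditional of \<open>m\<close> are normalised for each \<open>x\<close>.\<close>

lemma gibbs_inequality:
  assumes m: "nonneg_vec m" and dom: "dominates q m"
    and q: "\<And>x y. 0 \<le> q x y" "\<And>x. (\<Sum>y\<in>UNIV. q x y) = 1"
  shows "cond_entropy m \<le> cross_entropy q m"
proof -
  have pointwise: "joint m x y * ln (q x y) - joint m x y * ln (conditional m x y)
      \<le> marginal m x * q x y - joint m x y" for x y
  proof (cases "joint m x y = 0")
    case True
    then show ?thesis by (simp add: q marginal_nonneg[OF m])
  next
    case False
    then have pos: "0 < joint m x y" "0 < marginal m x" "0 < q x y" "0 < conditional m x y"
      using joint_nonneg[OF m, of x y] joint_le_marginal[OF m, of x y] dom
        dominates_conditional[OF m] by (auto simp: dominates_def)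
    have "ln (q x y) - ln (conditional m x y) \<le> (q x y - conditional m x y) / conditional m x y"
      using pos by (intro ln_diff_le) auto
    also have "\<dots> = (marginal m x * q x y - joint m x y) / joint m x y"
      using pos by (simp add: conditional_def field_simps)
    finally show ?thesis
      using pos by (simp add: field_simps)
  qed
  have "cond_entropy m - cross_entropy q m
      = (\<Sum>x\<in>UNIV. \<Sum>y\<in>UNIV. joint m x y * ln (q x y) - joint m x y * ln (conditional m x y))"
    by (simp add: cond_entropy_eq_cross_entropy[OF m] cross_entropy_def sum_subtractf)
  also have "\<dots> \<le> (\<Sum>x\<in>UNIV. \<Sum>y\<in>UNIV. marginal m x * q x y - joint m x y)"
    by (intro sum_mono pointwise)
  also have "\<dots> = 0"
    by (simp add: sum_subtractf q marginal_def flip: sum_distrib_left)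
  finally show ?thesis by simp
qed

text \<open>The risk is affine in the graph point \<open>(\<theta>, cond_entropy \<theta>)\<close>. This is what turns integration of
the risk against a prior into evaluation at a single finite-dimensional point.\<close>

lemma kl_risk_eq:
  assumes t: "nonneg_vec \<theta>" and q: "\<And>x y. 0 \<le> q x y"
  shows "kl_risk q \<theta> =
    (if dominates q \<theta> then ereal (cross_entropy q \<theta> - cond_entropy \<theta>) else \<infinity>)"
proof (cases "dominates q \<theta>")
  case True
  have "kl_term q \<theta> x y =
      ereal (joint \<theta> x y * ln (conditional \<theta> x y) - joint \<theta> x y * ln (q x y))" for x y
  proof (cases "joint \<theta> x y = 0")
    case False
    then have "0 < q x y" "0 < conditional \<theta> x y"
      using joint_nonneg[OF t, of x y] True dominates_conditional[OF t]
      by (auto simp: dominates_def)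
    then show ?thesis
      using False by (simp add: kl_term_def ln_div algebra_simps)
  qed (simp add: kl_term_def)
  then show ?thesis
    using True by (simp add: kl_risk_def cond_entropy_eq_cross_entropy[OF t] cross_entropy_def
        sum_subtractf)
next
  case False
  then obtain x y where xy: "0 < joint \<theta> x y" "q x y = 0"
    using q by (auto simp: dominates_def le_less)
  then have "kl_term q \<theta> x y = \<infinity>"
    by (simp add: kl_term_def)
  moreover have "kl_term q \<theta> a b \<noteq> -\<infinity>" for a b
    by (simp add: kl_term_def)
  ultimately show ?thesis
    using False unfolding kl_risk_def
    by (auto simp: sum_Pinfty intro!: exI[of _ x] exI[of _ y])
qed

text \<open>Lower semicontinuity of the cross entropy in \<open>q\<close>. Since \<open>q \<le> 1\<close>, no summand is negative, so the
bound on the sum bounds each summand; this keeps \<open>q x y\<close> away from \<open>0\<close> wherever \<open>m\<close> has mass and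
yields domination in the limit as well.\<close>

lemma cross_entropy_limit_le:
  fixes m :: "real ^ ('x::finite \<times> 'y::finite)"
  assumes m: "nonneg_vec m"
    and qs: "\<And>n x y. qs n x y \<in> {0..1}" "\<And>n. dominates (qs n) m"
    and lim: "\<And>x y. (\<lambda>n. qs n x y) \<longlonglongrightarrow> q x y"
    and le: "\<And>n. cross_entropy (qs n) m \<le> b n" and b: "b \<longlonglongrightarrow> B"
  shows "dominates q m \<and> cross_entropy q m \<le> B"
proof -
  obtain K where K: "b n \<le> K" for n
    using Bseq_eq_bounded convergent_imp_Bseq[OF convergentI[OF b]] Bseq_def abs_le_D1 real_norm_def
    by metis
  have pos: "0 < q x y" if xy: "0 < joint m x y" for x y
  proof -
    have "exp (- K / joint m x y) \<le> qs n x y" for n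
    proof -
      have nn: "0 \<le> - (joint m a c * ln (qs n a c))" for a c
        using joint_nonneg[OF m, of a c] qs(1)[of n a c]
        by (cases "qs n a c = 0") (auto simp: mult_nonneg_nonpos)
      have "- (joint m x y * ln (qs n x y)) \<le> (\<Sum>c\<in>UNIV. - (joint m x c * ln (qs n x c)))"
        by (rule member_le_sum) (use nn in auto)
      also have "\<dots> \<le> (\<Sum>a\<in>UNIV. \<Sum>c\<in>UNIV. - (joint m a c * ln (qs n a c)))"
        by (rule member_le_sum) (use nn in \<open>auto intro!: sum_nonneg simp del: sum_negf\<close>)
      also have "\<dots> = cross_entropy (qs n) m"
        by (simp add: cross_entropy_def sum_negf)
      finally have "- K / joint m x y \<le> ln (qs n x y)"
        using le[of n] K[of n] xy by (simp add: field_simps)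
      moreover have "0 < qs n x y"
        using qs(2) xy by (auto simp: dominates_def)
      ultimately show ?thesis
        by (simp add: ln_ge_iff)
    qed
    then have "exp (- K / joint m x y) \<le> q x y"
      by (intro LIMSEQ_le_const[OF lim]) auto
    then show ?thesis
      using exp_gt_zero less_le_trans by blast
  qed
  have "(\<lambda>n. joint m x y * ln (qs n x y)) \<longlonglongrightarrow> joint m x y * ln (q x y)" for x y
  proof (cases "joint m x y = 0")
    case False
    then have "0 < q x y"
      using pos joint_nonneg[OF m, of x y] by simp
    then show ?thesis
      by (intro tendsto_intros lim) auto
  qed simp
  then have "(\<lambda>n. cross_entropy (qs n) m) \<longlonglongrightarrow> cross_entropy q m"
    unfolding cross_entropy_def by (intro tendsto_minus tendsto_sum)
  then show ?thesis
    using pos LIMSEQ_le[OF _ b] le unfolding dominates_def by blast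
qed

text \<open>Mixing weights of this form lie strictly between \<open>0\<close> and \<open>1\<close> already at \<open>n = 0\<close>.\<close>

lemma weight_tendsto_0: "(\<lambda>n. 1 / (real n + 2)) \<longlonglongrightarrow> 0"
  by real_asymp

text \<open>The first-order condition for a maximum of the concave function \<open>cond_entropy m - g\<close> at \<open>(m, g)\<close> in
the direction of \<open>(m', g')\<close>, obtained without differentiating. With \<open>m_u = (1 - u) m + u m'\<close> and \<open>q_u\<close> its
conditional, \<open>cond_entropy m_u = (1 - u) cross_entropy q_u m + u cross_entropy q_u m'\<close>, and the
first summand is at least \<open>(1 - u) cond_entropy m\<close> by the Gibbs inequality. Maximality
therefore gives \<open>cross_entropy q_u m' - g' \<le> cond_entropy m - g\<close>; semicontinuity lets \<open>u\<close> tend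
to \<open>0\<close>. An ordinary derivative would be \<open>\<infinity>\<close> when \<open>m'\<close> has mass where \<open>m\<close> has none, which
this argument excludes automatically.\<close>

lemma maximality_bounds_cross_entropy:
  fixes m m' :: "real ^ ('x::finite \<times> 'y::finite)"
  assumes m: "nonneg_vec m" "\<And>x. 0 < marginal m x" and m': "nonneg_vec m'"
    and max: "\<And>u. 0 < u \<Longrightarrow> u < 1 \<Longrightarrow>
      cond_entropy ((1 - u) *\<^sub>R m + u *\<^sub>R m') - ((1 - u) * g + u * g') \<le> cond_entropy m - g"
  shows "dominates (conditional m) m' \<and>
    cross_entropy (conditional m) m' - g' \<le> cond_entropy m - g"
proof -
  define u where "u n = 1 / (real n + 2)" for n :: nat
  define mm where "mm n = (1 - u n) *\<^sub>R m + u n *\<^sub>R m'" for n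
  have u: "0 < u n" "u n < 1" for n
    by (auto simp: u_def field_simps)
  have "u \<longlonglongrightarrow> 0"
    unfolding u_def by (rule weight_tendsto_0)
  then have "mm \<longlonglongrightarrow> (1 - 0) *\<^sub>R m + 0 *\<^sub>R m'"
    unfolding mm_def by (intro tendsto_intros)
  then have mm_lim: "mm \<longlonglongrightarrow> m"
    by simp
  have mm: "nonneg_vec (mm n)" for n
    unfolding mm_def using u[of n] m m' by (intro nonneg_vec_mix) auto
  have mm_pos: "0 < marginal (mm n) x" for n x
    unfolding mm_def marginal_mix using u[of n] m(2)[of x] marginal_nonneg[OF m', of x]
    by (intro add_pos_nonneg) auto
  note pd = predictive_density_conditional[OF mm mm_pos]
  have dom: "dominates (conditional (mm n)) m" "dominates (conditional (mm n)) m'" for n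
  proof -
    have "0 < joint (mm n) x y" if "0 < joint m x y \<or> 0 < joint m' x y" for x y
      using that u[of n] joint_nonneg[OF m(1), of x y] joint_nonneg[OF m', of x y]
      unfolding mm_def joint_mix by (auto intro: add_pos_nonneg add_nonneg_pos)
    then show "dominates (conditional (mm n)) m" "dominates (conditional (mm n)) m'"
      using dominates_conditional[OF mm, of n] by (auto simp: dominates_def)
  qed
  have "dominates (conditional m) m' \<and>
    cross_entropy (conditional m) m' \<le> cond_entropy m - g + g'"
  proof (rule cross_entropy_limit_le[OF m'])
    show "conditional (mm n) x y \<in> {0..1}" for n x y
      by (rule conditional_range[OF mm])
    show "dominates (conditional (mm n)) m'" for n
      by (rule dom)
    show "(\<lambda>n. conditional (mm n) x y) \<longlonglongrightarrow> conditional m x y" for x y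
      using m(2)[of x] by (intro tendsto_conditional mm_lim) simp
    show "cross_entropy (conditional (mm n)) m' \<le> cond_entropy m - g + g'" for n
    proof -
      have "cond_entropy m \<le> cross_entropy (conditional (mm n)) m"
        using pd[of n] unfolding predictive_density_def
        by (intro gibbs_inequality m dom) auto
      then have "(1 - u n) * cond_entropy m + u n * cross_entropy (conditional (mm n)) m'
          \<le> (1 - u n) * cross_entropy (conditional (mm n)) m
            + u n * cross_entropy (conditional (mm n)) m'"
        using u[of n] by simp
      also have "\<dots> = cond_entropy (mm n)"
        unfolding cond_entropy_eq_cross_entropy[OF mm] by (simp only: mm_def cross_entropy_mix)
      also have "\<dots> \<le> cond_entropy m - g + ((1 - u n) * g + u n * g')"
        using max[OF u, of n] unfolding mm_def by linarith
      finally have "u n * cross_entropy (conditional (mm n)) m' \<le> u n * (cond_entropy m - g + g')"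
        by (simp add: algebra_simps)
      then show ?thesis
        using u[of n] by simp
    qed
  qed simp
  then show ?thesis by simp
qed

section \<open>Priors and their moments\<close>

definition barycentre :: "(real ^ 'n::finite) measure \<Rightarrow> real ^ 'n" where
  "barycentre \<pi> = (\<chi> i. \<integral>\<theta>. \<theta> $ i \<partial>\<pi>)"

text \<open>By \<open>cond_mutual_info_eq\<close> below, these finitely many moments determine the conditional mutual
information of a prior.\<close>

definition moments :: "(real ^ ('x::finite \<times> 'y::finite)) measure \<Rightarrow> (real ^ ('x \<times> 'y)) \<times> real" where
  "moments \<pi> = (barycentre \<pi>, \<integral>\<theta>. cond_entropy \<theta> \<partial>\<pi>)"

text \<open>The convex hull is already closed, as the hull of a compact set in a finite-dimensional space,
and its points are moments of priors; so maximising over it needs no topology on measures.\<close>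

definition moment_body ::
  "(real ^ ('x::finite \<times> 'y::finite)) set \<Rightarrow> ((real ^ ('x \<times> 'y)) \<times> real) set" where
  "moment_body \<Theta> = convex hull ((\<lambda>\<theta>. (\<theta>, cond_entropy \<theta>)) ` \<Theta>)"

lemma joint_barycentre: "joint (barycentre \<pi>) x y = mix_joint \<pi> x y"
  by (simp add: barycentre_def mix_joint_def joint_def)

lemma compact_moment_body: "compact \<Theta> \<Longrightarrow> compact (moment_body \<Theta>)"
  unfolding moment_body_def
  by (intro compact_convex_hull compact_continuous_image continuous_intros)

lemma convex_moment_body: "convex (moment_body \<Theta>)"
  unfolding moment_body_def by (rule convex_convex_hull)

lemma graph_point_in_moment_body: "\<theta> \<in> \<Theta> \<Longrightarrow> (\<theta>, cond_entropy \<theta>) \<in> moment_body \<Theta>"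
  unfolding moment_body_def by (intro hull_inc) auto

text \<open>The convex combination \<open>(1 - u) \<pi> + u \<pi>'\<close>, written as a two-stage draw: a coin of bias \<open>u\<close>
selects the prior from which \<open>\<theta>\<close> is then drawn.\<close>

definition mix_prior :: "real \<Rightarrow> 'a measure \<Rightarrow> 'a measure \<Rightarrow> 'a measure" where
  "mix_prior u \<pi> \<pi>' = measure_pmf (bernoulli_pmf u) \<bind> (\<lambda>b. if b then \<pi>' else \<pi>)"

lemma space_prior: "\<pi> \<in> priors \<Theta> \<Longrightarrow> space \<pi> = \<Theta>"
  using sets_eq_imp_space_eq[of \<pi> "restrict_space borel \<Theta>"]
  by (simp add: priors_def space_restrict_space)

lemma prior_measurable:
  fixes f :: "'a::topological_space \<Rightarrow> real"
  assumes "\<pi> \<in> priors \<Theta>" "continuous_on \<Theta> f"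
  shows "f \<in> borel_measurable \<pi>"
proof -
  have "sets \<pi> = sets (restrict_space borel \<Theta>)"
    using assms(1) by (simp add: priors_def)
  then show ?thesis
    using borel_measurable_continuous_on_restrict[OF assms(2)]
      measurable_cong_sets[of \<pi> "restrict_space borel \<Theta>" borel borel] by simp
qed

lemma prior_integrable:
  fixes f :: "'a::topological_space \<Rightarrow> real"
  assumes "compact \<Theta>" "\<pi> \<in> priors \<Theta>" "continuous_on \<Theta> f"
  shows "integrable \<pi> f"
proof -
  interpret prob_space \<pi> using assms(2) by (simp add: priors_def)
  have "bounded (f ` \<Theta>)"
    using assms compact_continuous_image compact_imp_bounded by blast
  then obtain B where "\<forall>\<theta>\<in>\<Theta>. norm (f \<theta>) \<le> B"
    by (auto simp: bounded_iff)
  then show ?thesis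
    using space_prior[OF assms(2)] prior_measurable[OF assms(2,3)]
    by (intro integrable_const_bound[of _ B]) auto
qed

lemma return_in_priors: "\<theta> \<in> \<Theta> \<Longrightarrow> return (restrict_space borel \<Theta>) \<theta> \<in> priors \<Theta>"
  by (simp add: priors_def space_restrict_space prob_space_return)

lemma integral_return_prior:
  fixes f :: "'a::topological_space \<Rightarrow> real"
  assumes "\<theta> \<in> \<Theta>" "continuous_on \<Theta> f"
  shows "(\<integral>t. f t \<partial>return (restrict_space borel \<Theta>) \<theta>) = f \<theta>"
  by (rule integral_return)
    (simp_all add: assms borel_measurable_continuous_on_restrict space_restrict_space)

lemma mix_kernel_measurable:
  assumes "\<pi> \<in> priors \<Theta>" "\<pi>' \<in> priors \<Theta>"
  shows "(\<lambda>b. if b then \<pi>' else \<pi>) \<in> measure_pmf p \<rightarrow>\<^sub>M prob_algebra (restrict_space borel \<Theta>)"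
  using assms unfolding measurable_pmf_measure1 by (simp add: priors_def space_prob_algebra)

lemma mix_prior_in_priors:
  assumes "\<pi> \<in> priors \<Theta>" "\<pi>' \<in> priors \<Theta>"
  shows "mix_prior u \<pi> \<pi>' \<in> priors \<Theta>"
proof -
  let ?p = "measure_pmf (bernoulli_pmf u)"
  have p: "?p \<in> space (prob_algebra (count_space UNIV))"
    by (simp add: space_prob_algebra prob_space_measure_pmf)
  have k: "(\<lambda>b. if b then \<pi>' else \<pi>) \<in> count_space UNIV \<rightarrow>\<^sub>M prob_algebra (restrict_space borel \<Theta>)"
    using mix_kernel_measurable[OF assms, of "bernoulli_pmf u"]
    by (simp only: measurable_pmf_measure1 measurable_count_space_eq1)
  show ?thesis
    unfolding mix_prior_def priors_def mem_Collect_eq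
    by (intro conjI prob_space_bind'[OF p k] sets_bind'[OF p k])
qed

lemma integral_mix_prior:
  fixes f :: "'a::topological_space \<Rightarrow> real"
  assumes \<pi>: "\<pi> \<in> priors \<Theta>" "\<pi>' \<in> priors \<Theta>" and u: "0 \<le> u" "u \<le> 1"
    and f: "continuous_on \<Theta> f" "bounded (f ` \<Theta>)"
  shows "(\<integral>\<theta>. f \<theta> \<partial>mix_prior u \<pi> \<pi>') = (1 - u) * (\<integral>\<theta>. f \<theta> \<partial>\<pi>) + u * (\<integral>\<theta>. f \<theta> \<partial>\<pi>')"
proof -
  obtain B where B: "\<forall>\<theta>\<in>\<Theta>. norm (f \<theta>) \<le> B"
    using f(2) by (auto simp: bounded_iff)
  have "(\<integral>\<theta>. f \<theta> \<partial>mix_prior u \<pi> \<pi>')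
      = (\<integral>b. (\<integral>\<theta>. f \<theta> \<partial>(if b then \<pi>' else \<pi>)) \<partial>measure_pmf (bernoulli_pmf u))"
    unfolding mix_prior_def
  proof (rule integral_bind[where K = "restrict_space borel \<Theta>" and B = B and B' = 1])
    show "f \<in> borel_measurable (restrict_space borel \<Theta>)"
      by (rule borel_measurable_continuous_on_restrict[OF f(1)])
    show "\<bar>f \<theta>\<bar> \<le> B" if "\<theta> \<in> space (restrict_space borel \<Theta>)" for \<theta>
      using that B by (simp add: space_restrict_space)
    show "(\<lambda>b. if b then \<pi>' else \<pi>)
        \<in> measure_pmf (bernoulli_pmf u) \<rightarrow>\<^sub>M subprob_algebra (restrict_space borel \<Theta>)"
      by (rule measurable_prob_algebraD[OF mix_kernel_measurable[OF \<pi>]])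
    show "finite_measure (measure_pmf (bernoulli_pmf u))"
      by (rule prob_space.finite_measure[OF prob_space_measure_pmf])
    have "emeasure \<pi> (space \<pi>) \<le> ennreal 1" "emeasure \<pi>' (space \<pi>') \<le> ennreal 1"
      using \<pi> by (simp_all add: priors_def prob_space.emeasure_space_1)
    then show "AE b in measure_pmf (bernoulli_pmf u).
        emeasure (if b then \<pi>' else \<pi>) (space (if b then \<pi>' else \<pi>)) \<le> ennreal 1"
      by (intro AE_I2) auto
  qed
  then show ?thesis
    using u by simp
qed

lemma continuous_on_bounded:
  fixes f :: "'a::topological_space \<Rightarrow> real"
  shows "compact \<Theta> \<Longrightarrow> continuous_on \<Theta> f \<Longrightarrow> bounded (f ` \<Theta>)"
  by (rule compact_imp_bounded[OF compact_continuous_image])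

section \<open>From risk bounds to minimaxity\<close>

locale compact_model =
  fixes \<Theta> :: "(real ^ ('x::finite \<times> 'y::finite)) set"
  assumes compact: "compact \<Theta>" and nonneg: "\<And>\<theta>. \<theta> \<in> \<Theta> \<Longrightarrow> nonneg_vec \<theta>"
begin

lemma marginal_barycentre:
  assumes "\<pi> \<in> priors \<Theta>"
  shows "marginal (barycentre \<pi>) x = mix_marginal \<pi> x"
  unfolding marginal_def joint_barycentre mix_marginal_def mix_joint_def
  by (intro Bochner_Integration.integral_sum[symmetric] prior_integrable[OF compact assms]
      continuous_on_joint)

lemma bayes_predictive_eq:
  "\<pi> \<in> priors \<Theta> \<Longrightarrow> bayes_predictive \<pi> = conditional (barycentre \<pi>)"
  by (intro ext) (simp add: bayes_predictive_def conditional_def joint_barycentre marginal_barycentre)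

lemma nonneg_barycentre: "\<pi> \<in> priors \<Theta> \<Longrightarrow> nonneg_vec (barycentre \<pi>)"
  using nonneg space_prior[of \<pi> \<Theta>]
  by (auto simp: nonneg_vec_def barycentre_def intro!: Bochner_Integration.integral_nonneg)

lemma cond_mutual_info_eq:
  assumes \<pi>: "\<pi> \<in> priors \<Theta>"
  shows "cond_mutual_info \<pi> = cond_entropy (barycentre \<pi>) - (\<integral>\<theta>. cond_entropy \<theta> \<partial>\<pi>)"
proof -
  note c = continuous_on_compose2[OF continuous_x_ln_x _ subset_UNIV]
  have "integrable \<pi> (\<lambda>\<theta>. \<Sum>x\<in>UNIV. \<Sum>y\<in>UNIV. joint \<theta> x y * ln (joint \<theta> x y))"
    "integrable \<pi> (\<lambda>\<theta>. \<Sum>x\<in>UNIV. marginal \<theta> x * ln (marginal \<theta> x))"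
    by (intro prior_integrable[OF compact \<pi>] continuous_intros c)+
  then show ?thesis
    by (simp add: cond_mutual_info_def cond_entropy_def joint_barycentre marginal_barycentre[OF \<pi>])
qed

lemma cross_entropy_barycentre:
  assumes \<pi>: "\<pi> \<in> priors \<Theta>"
  shows "cross_entropy q (barycentre \<pi>) = (\<integral>\<theta>. cross_entropy q \<theta> \<partial>\<pi>)"
proof -
  have "integrable \<pi> (\<lambda>\<theta>. joint \<theta> x y)" for x y
    by (intro prior_integrable[OF compact \<pi>] continuous_intros)
  then show ?thesis
    by (simp add: cross_entropy_def joint_barycentre mix_joint_def)
qed

lemma dominates_barycentre:
  assumes \<pi>: "\<pi> \<in> priors \<Theta>" and dom: "\<And>\<theta>. \<theta> \<in> \<Theta> \<Longrightarrow> dominates q \<theta>"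
  shows "dominates q (barycentre \<pi>)"
  unfolding dominates_def joint_barycentre mix_joint_def
proof (intro allI impI, rule ccontr)
  fix x y
  assume pos: "0 < (\<integral>\<theta>. joint \<theta> x y \<partial>\<pi>)" and q: "\<not> 0 < q x y"
  have "joint \<theta> x y = 0" if "\<theta> \<in> space \<pi>" for \<theta>
    using that q dom[of \<theta>] joint_nonneg[OF nonneg, of \<theta> x y] space_prior[OF \<pi>]
    by (force simp: dominates_def)
  then have "(\<integral>\<theta>. joint \<theta> x y \<partial>\<pi>) = (\<integral>\<theta>. 0 \<partial>\<pi>)"
    by (intro Bochner_Integration.integral_cong) auto
  with pos show False by simp
qed

text \<open>Easy half of the saddle-point relation: the integrated risk
\<open>cross_entropy q (barycentre \<pi>) - \<integral>cond_entropy\<close> of any \<open>q\<close> is at least the information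
of \<open>\<pi>\<close>, by the Gibbs inequality at the barycentre.\<close>

lemma cond_mutual_info_le:
  assumes \<pi>: "\<pi> \<in> priors \<Theta>" and q: "predictive_density q"
    and le: "\<And>\<theta>. \<theta> \<in> \<Theta> \<Longrightarrow> kl_risk q \<theta> \<le> ereal c"
  shows "cond_mutual_info \<pi> \<le> c"
proof -
  interpret prob_space \<pi> using \<pi> by (simp add: priors_def)
  have q': "0 \<le> q x y" "(\<Sum>y\<in>UNIV. q x y) = 1" for x y
    using q by (auto simp: predictive_density_def)
  have "dominates q \<theta> \<and> cross_entropy q \<theta> - cond_entropy \<theta> \<le> c" if "\<theta> \<in> \<Theta>" for \<theta>
    using le[OF that] kl_risk_eq[of \<theta> q, OF nonneg[OF that] q'(1)] by (auto split: if_splits)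
  then have risk: "dominates q \<theta>" "cross_entropy q \<theta> \<le> c + cond_entropy \<theta>" if "\<theta> \<in> \<Theta>" for \<theta>
    using that by (auto simp: algebra_simps)
  have ce: "continuous_on \<Theta> (cross_entropy q)"
    unfolding cross_entropy_def by (intro continuous_intros)
  note int = prior_integrable[OF compact \<pi>]
  have "cond_entropy (barycentre \<pi>) \<le> cross_entropy q (barycentre \<pi>)"
    using risk(1) by (intro gibbs_inequality nonneg_barycentre dominates_barycentre \<pi> q')
  also have "\<dots> = (\<integral>\<theta>. cross_entropy q \<theta> \<partial>\<pi>)"
    by (rule cross_entropy_barycentre[OF \<pi>])
  also have "\<dots> \<le> (\<integral>\<theta>. c + cond_entropy \<theta> \<partial>\<pi>)"
    using risk(2) space_prior[OF \<pi>] ce by (intro integral_mono int continuous_intros) auto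
  also have "\<dots> = c + (\<integral>\<theta>. cond_entropy \<theta> \<partial>\<pi>)"
    using int[OF continuous_on_cond_entropy] by (simp add: prob_space)
  finally show ?thesis
    by (simp add: cond_mutual_info_eq[OF \<pi>])
qed

text \<open>The information of \<open>\<pi>\<close> bounds the maximal risk of every predictive density from below by
\<open>cond_mutual_info_le\<close>; a density whose risk never exceeds it attains the infimum.\<close>

lemma minimax_if_risk_le_information:
  assumes \<pi>: "\<pi> \<in> priors \<Theta>" and q: "predictive_density q"
    and le: "\<And>\<theta>. \<theta> \<in> \<Theta> \<Longrightarrow> kl_risk q \<theta> \<le> ereal (cond_mutual_info \<pi>)"
  shows "minimax \<Theta> q"
proof -
  have "(SUP \<theta>\<in>\<Theta>. kl_risk q \<theta>) \<le> (SUP \<theta>\<in>\<Theta>. kl_risk q' \<theta>)" if "predictive_density q'" for q'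
  proof -
    have "ereal (cond_mutual_info \<pi>) \<le> (SUP \<theta>\<in>\<Theta>. kl_risk q' \<theta>)"
    proof (rule ereal_le_real)
      fix c assume "(SUP \<theta>\<in>\<Theta>. kl_risk q' \<theta>) \<le> ereal c"
      then show "ereal (cond_mutual_info \<pi>) \<le> ereal c"
        using cond_mutual_info_le[OF \<pi> that, of c] by (simp add: SUP_le_iff)
    qed
    then show ?thesis
      using le by (meson SUP_least order_trans)
  qed
  then show ?thesis
    using q unfolding minimax_def by (auto intro!: antisym INF_greatest INF_lower)
qed

lemma moments_mix_prior:
  assumes "\<pi> \<in> priors \<Theta>" "\<pi>' \<in> priors \<Theta>" "0 \<le> u" "u \<le> 1"
  shows "moments (mix_prior u \<pi> \<pi>') = (1 - u) *\<^sub>R moments \<pi> + u *\<^sub>R moments \<pi>'"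
proof -
  have "continuous_on \<Theta> (\<lambda>\<theta>. \<theta> $ i)" for i
    by (intro continuous_intros)
  then have "barycentre (mix_prior u \<pi> \<pi>') = (1 - u) *\<^sub>R barycentre \<pi> + u *\<^sub>R barycentre \<pi>'"
    unfolding vec_eq_iff
    by (simp add: barycentre_def integral_mix_prior[OF assms] continuous_on_bounded[OF compact])
  then show ?thesis
    by (simp add: moments_def integral_mix_prior[OF assms] continuous_on_bounded[OF compact]
        continuous_on_cond_entropy)
qed

lemma moments_return:
  assumes "\<theta> \<in> \<Theta>"
  shows "moments (return (restrict_space borel \<Theta>) \<theta>) = (\<theta>, cond_entropy \<theta>)"
proof -
  have "(\<integral>t. t $ i \<partial>return (restrict_space borel \<Theta>) \<theta>) = \<theta> $ i" for i
    by (intro integral_return_prior assms continuous_intros)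
  then show ?thesis
    using integral_return_prior[OF assms continuous_on_cond_entropy]
    by (simp add: moments_def barycentre_def vec_eq_iff)
qed

text \<open>Mixing priors shows that the attainable moments form a convex set, and point masses show that
it contains the graph, hence the hull.\<close>

lemma moment_body_realised:
  assumes "c \<in> moment_body \<Theta>"
  obtains \<pi> where "\<pi> \<in> priors \<Theta>" "moments \<pi> = c"
proof -
  have "convex (moments ` priors \<Theta>)"
    unfolding convex_alt
  proof (intro ballI allI impI, elim conjE imageE)
    fix a b \<pi> \<pi>' and u :: real
    assume "0 \<le> u" "u \<le> 1" "a = moments \<pi>" "b = moments \<pi>'" "\<pi> \<in> priors \<Theta>" "\<pi>' \<in> priors \<Theta>"
    then show "(1 - u) *\<^sub>R a + u *\<^sub>R b \<in> moments ` priors \<Theta>"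
      by (metis imageI mix_prior_in_priors moments_mix_prior)
  qed
  moreover have "(\<lambda>\<theta>. (\<theta>, cond_entropy \<theta>)) ` \<Theta> \<subseteq> moments ` priors \<Theta>"
    using moments_return return_in_priors by (metis (no_types, lifting) image_subset_iff imageI)
  ultimately have "moment_body \<Theta> \<subseteq> moments ` priors \<Theta>"
    unfolding moment_body_def by (intro hull_minimal)
  then show ?thesis
    using assms that by auto
qed

lemma nonneg_moment_body: "c \<in> moment_body \<Theta> \<Longrightarrow> nonneg_vec (fst c)"
  using moment_body_realised nonneg_barycentre by (metis fst_conv moments_def)

text \<open>The first-order condition along \<open>(1 - u) \<pi> + u \<delta>_\<theta>\<close> bounds the risk at \<open>\<theta>\<close> by the
information of \<open>\<pi>\<close>.\<close>

lemma minimax_bayes_predictive: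
  assumes \<pi>: "\<pi> \<in> priors \<Theta>"
    and max: "\<And>\<pi>'. \<pi>' \<in> priors \<Theta> \<Longrightarrow> cond_mutual_info \<pi>' \<le> cond_mutual_info \<pi>"
    and pos: "\<And>x. 0 < mix_marginal \<pi> x"
  shows "minimax \<Theta> (bayes_predictive \<pi>)"
proof (rule minimax_if_risk_le_information[OF \<pi>])
  let ?m = "barycentre \<pi>" and ?g = "\<integral>\<theta>. cond_entropy \<theta> \<partial>\<pi>"
  have pos': "0 < marginal ?m x" for x
    using pos by (simp add: marginal_barycentre[OF \<pi>])
  show "predictive_density (bayes_predictive \<pi>)"
    unfolding bayes_predictive_eq[OF \<pi>]
    by (intro predictive_density_conditional nonneg_barycentre \<pi> pos')
  fix \<theta> assume \<theta>: "\<theta> \<in> \<Theta>"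
  have "dominates (conditional ?m) \<theta> \<and>
      cross_entropy (conditional ?m) \<theta> - cond_entropy \<theta> \<le> cond_entropy ?m - ?g"
  proof (rule maximality_bounds_cross_entropy[OF nonneg_barycentre[OF \<pi>] pos' nonneg[OF \<theta>]])
    fix u :: real assume u: "0 < u" "u < 1"
    let ?\<pi> = "mix_prior u \<pi> (return (restrict_space borel \<Theta>) \<theta>)"
    have \<pi>': "?\<pi> \<in> priors \<Theta>"
      by (intro mix_prior_in_priors \<pi> return_in_priors \<theta>)
    have "moments ?\<pi> = (1 - u) *\<^sub>R (?m, ?g) + u *\<^sub>R (\<theta>, cond_entropy \<theta>)"
      using u by (simp add: moments_mix_prior[OF \<pi> return_in_priors[OF \<theta>]] moments_return[OF \<theta>])
        (simp add: moments_def)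
    then show "cond_entropy ((1 - u) *\<^sub>R ?m + u *\<^sub>R \<theta>) - ((1 - u) * ?g + u * cond_entropy \<theta>)
        \<le> cond_entropy ?m - ?g"
      using max[OF \<pi>'] unfolding cond_mutual_info_eq[OF \<pi>] cond_mutual_info_eq[OF \<pi>']
      by (simp add: moments_def)
  qed
  then show "kl_risk (bayes_predictive \<pi>) \<theta> \<le> ereal (cond_mutual_info \<pi>)"
    using conditional_range[OF nonneg_barycentre[OF \<pi>]]
    by (subst kl_risk_eq[OF nonneg[OF \<theta>]])
      (auto simp: bayes_predictive_eq[OF \<pi>] cond_mutual_info_eq[OF \<pi>])
qed

end

section \<open>Maximisers with positive marginals and their limits\<close>

text \<open>The conditional mutual information of a prior with moments \<open>c\<close>.\<close>

definition information :: "(real ^ ('x::finite \<times> 'y::finite)) \<times> real \<Rightarrow> real" where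
  "information c = cond_entropy (fst c) - snd c"

text \<open>A maximiser over all of \<open>C\<close> may have vanishing marginals, and then its conditional is not
a predictive density. Maximising over the copy of \<open>C\<close> shrunk towards \<open>c0\<close> forces positive marginals. The first-order
condition now only holds towards points \<open>(1 - e) c' + e c0\<close>; the contribution of
\<open>c0\<close> is bounded below by the Gibbs inequality, and what remains is a bound for \<open>c'\<close> with an error
that vanishes with \<open>e\<close>.\<close>

lemma regularized_maximizer:
  fixes C :: "((real ^ ('x::finite \<times> 'y::finite)) \<times> real) set"
  assumes C: "compact C" "convex C" "\<And>c. c \<in> C \<Longrightarrow> nonneg_vec (fst c)"
    and c0: "c0 \<in> C" "\<And>x. 0 < marginal (fst c0) x" and e: "0 < e" "e < 1"
  obtains c where "c \<in> C" "\<And>x. 0 < marginal (fst c) x"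
    "\<And>c'. c' \<in> C \<Longrightarrow> dominates (conditional (fst c)) (fst c')"
    "\<And>c'. c' \<in> C \<Longrightarrow> (1 - e) * (cross_entropy (conditional (fst c)) (fst c') - snd c')
        + e * information c0 \<le> information c"
proof -
  define blend where "blend c = (1 - e) *\<^sub>R c + e *\<^sub>R c0" for c
  have "compact (blend ` C)"
    unfolding blend_def by (intro compact_continuous_image continuous_intros C)
  moreover have "continuous_on (blend ` C) information"
    unfolding information_def
    by (intro continuous_intros continuous_on_compose2[OF continuous_on_cond_entropy[of UNIV]]) auto
  ultimately have "\<exists>c\<in>C. \<forall>c'\<in>C. information (blend c') \<le> information (blend c)"
    using continuous_attains_sup[of "blend ` C" information] c0(1) by auto
  then obtain c1 where c1: "c1 \<in> C" "\<And>c. c \<in> C \<Longrightarrow> information (blend c) \<le> information (blend c1)"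
    by blast
  define c where "c = blend c1"
  have blend_in: "blend c \<in> C" if "c \<in> C" for c
    unfolding blend_def using C(2) that c0(1) e by (auto simp: convex_alt)
  have cC: "c \<in> C"
    unfolding c_def by (rule blend_in[OF c1(1)])
  have pos: "0 < marginal (fst c) x" for x
    using e c0(2)[of x] marginal_nonneg[OF C(3)[OF c1(1)], of x]
    by (simp add: c_def blend_def marginal_mix add_nonneg_pos)
  \<comment> \<open>The segment from \<open>c\<close> to \<open>blend c'\<close> stays in the shrunken copy, over which \<open>c\<close> is maximal.\<close>
  have key: "dominates (conditional (fst c)) (fst (blend c')) \<and>
      cross_entropy (conditional (fst c)) (fst (blend c')) - snd (blend c') \<le> information c"
    if c': "c' \<in> C" for c'
    unfolding information_def
  proof (rule maximality_bounds_cross_entropy[OF C(3)[OF cC] pos C(3)[OF blend_in[OF c']]])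
    fix u :: real assume u: "0 < u" "u < 1"
    have "(1 - u) *\<^sub>R c + u *\<^sub>R blend c' = blend ((1 - u) *\<^sub>R c1 + u *\<^sub>R c')"
      by (simp add: c_def blend_def algebra_simps)
    moreover have "(1 - u) *\<^sub>R c1 + u *\<^sub>R c' \<in> C"
      using C(2) c1(1) c' u by (auto simp: convex_alt)
    ultimately have "information ((1 - u) *\<^sub>R c + u *\<^sub>R blend c') \<le> information c"
      using c1(2) by (simp add: c_def)
    then show "cond_entropy ((1 - u) *\<^sub>R fst c + u *\<^sub>R fst (blend c'))
        - ((1 - u) * snd c + u * snd (blend c')) \<le> cond_entropy (fst c) - snd c"
      by (simp add: information_def)
  qed
  have dom: "dominates (conditional (fst c)) (fst c')" if c': "c' \<in> C" for c'
  proof -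
    have "0 < joint (fst (blend c')) x y" if "0 < joint (fst c') x y" for x y
      using that e joint_nonneg[OF C(3)[OF c0(1)], of x y]
      by (auto simp: blend_def joint_mix intro: add_pos_nonneg)
    then show ?thesis
      using key[OF c'] by (auto simp: dominates_def)
  qed
  show thesis
  proof (rule that[OF cC pos])
    fix c' assume c': "c' \<in> C"
    show "dominates (conditional (fst c)) (fst c')"
      by (rule dom[OF c'])
    have "cond_entropy (fst c0) \<le> cross_entropy (conditional (fst c)) (fst c0)"
      using predictive_density_conditional[OF C(3)[OF cC] pos] unfolding predictive_density_def
      by (intro gibbs_inequality C(3) c0(1) dom) auto
    then have "e * information c0 \<le> e * (cross_entropy (conditional (fst c)) (fst c0) - snd c0)"
      using e by (simp add: information_def)
    moreover have "(1 - e) * (cross_entropy (conditional (fst c)) (fst c') - snd c')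
        + e * (cross_entropy (conditional (fst c)) (fst c0) - snd c0) \<le> information c"
    proof -
      have "fst (blend c') = (1 - e) *\<^sub>R fst c' + e *\<^sub>R fst c0"
        "snd (blend c') = (1 - e) * snd c' + e * snd c0"
        by (simp_all add: blend_def)
      then show ?thesis
        using key[OF c', THEN conjunct2] by (simp only: cross_entropy_mix) (simp add: algebra_simps)
    qed
    ultimately show "(1 - e) * (cross_entropy (conditional (fst c)) (fst c') - snd c')
        + e * information c0 \<le> information c"
      by linarith
  qed
qed

text \<open>Letting the shrinking factor tend to \<open>0\<close>, points and conditionals are extracted together from one
compact product. The limit \<open>q\<close> is defined even for those \<open>x\<close> whose marginal vanishes at the limit
point.\<close>

lemma limiting_maximizer:
  fixes C :: "((real ^ ('x::finite \<times> 'y::finite)) \<times> real) set"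
  assumes C: "compact C" "convex C" "\<And>c. c \<in> C \<Longrightarrow> nonneg_vec (fst c)"
    and c0: "c0 \<in> C" "\<And>x. 0 < marginal (fst c0) x"
  obtains cs c q where "\<And>n. cs n \<in> C" "\<And>n x. 0 < marginal (fst (cs n)) x" "c \<in> C"
    "cs \<longlonglongrightarrow> c" "\<And>x y. (\<lambda>n. conditional (fst (cs n)) x y) \<longlonglongrightarrow> q x y"
    "\<And>c'. c' \<in> C \<Longrightarrow> dominates q (fst c')"
    "\<And>c'. c' \<in> C \<Longrightarrow> cross_entropy q (fst c') - snd c' \<le> information c"
proof -
  define e where "e n = 1 / (real n + 2)" for n :: nat
  have e: "0 < e n" "e n < 1" for n
    by (auto simp: e_def field_simps)
  have "\<exists>c. c \<in> C \<and> (\<forall>x. 0 < marginal (fst c) x) \<and>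
      (\<forall>c'\<in>C. dominates (conditional (fst c)) (fst c') \<and>
        (1 - e n) * (cross_entropy (conditional (fst c)) (fst c') - snd c')
          + e n * information c0 \<le> information c)" for n
    by (rule regularized_maximizer[OF C c0 e[of n]]) blast+
  then obtain d where d: "\<And>n. d n \<in> C" "\<And>n x. 0 < marginal (fst (d n)) x"
    "\<And>n c'. c' \<in> C \<Longrightarrow> dominates (conditional (fst (d n))) (fst c')"
    "\<And>n c'. c' \<in> C \<Longrightarrow> (1 - e n) * (cross_entropy (conditional (fst (d n))) (fst c') - snd c')
          + e n * information c0 \<le> information (d n)"
    by metis
  \<comment> \<open>The conditionals are packed into a vector so that a single compactness argument serves both.\<close>
  define z where "z n = (d n, \<chi> i. conditional (fst (d n)) (fst i) (snd i))" for n
  have "z n \<in> C \<times> cbox 0 1" for n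
    using d(1) conditional_range[OF C(3)[OF d(1)]] by (auto simp: z_def mem_box_cart)
  moreover have "seq_compact (C \<times> cbox 0 (1 :: real ^ ('x \<times> 'y)))"
    by (intro compact_imp_seq_compact compact_Times C compact_cbox)
  ultimately obtain l r where l: "l \<in> C \<times> cbox 0 1" "strict_mono r" "(z \<circ> r) \<longlonglongrightarrow> l"
    by (blast elim: seq_compactE)
  have lim: "(\<lambda>n. d (r n)) \<longlonglongrightarrow> fst l"
    using tendsto_fst[OF l(3)] by (simp add: z_def o_def)
  have qlim: "(\<lambda>n. conditional (fst (d (r n))) x y) \<longlonglongrightarrow> snd l $ (x, y)" for x y
    using tendsto_vec_nth[OF tendsto_snd[OF l(3)], of "(x, y)"] by (simp add: z_def o_def)
  have "e \<longlonglongrightarrow> 0"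
    unfolding e_def by (rule weight_tendsto_0)
  then have er: "(\<lambda>n. e (r n)) \<longlonglongrightarrow> 0"
    using LIMSEQ_subseq_LIMSEQ[OF _ l(2)] by (simp add: o_def)
  have J: "(\<lambda>n. information (d (r n))) \<longlonglongrightarrow> information (fst l)"
    unfolding information_def by (intro tendsto_intros tendsto_cond_entropy lim)
  have bound: "dominates (\<lambda>x y. snd l $ (x, y)) (fst c') \<and>
      cross_entropy (\<lambda>x y. snd l $ (x, y)) (fst c') \<le> snd c' + information (fst l)"
    if c': "c' \<in> C" for c'
  proof (rule cross_entropy_limit_le[OF C(3)[OF c']])
    show "conditional (fst (d (r n))) x y \<in> {0..1}" for n x y
      by (rule conditional_range[OF C(3)[OF d(1)]])
    show "dominates (conditional (fst (d (r n)))) (fst c')" for n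
      by (rule d(3)[OF c'])
    show "cross_entropy (conditional (fst (d (r n)))) (fst c')
        \<le> snd c' + (information (d (r n)) - e (r n) * information c0) / (1 - e (r n))" for n
      using d(4)[OF c', of "r n"] e[of "r n"] by (simp add: field_simps)
    have "(\<lambda>n. snd c' + (information (d (r n)) - e (r n) * information c0) / (1 - e (r n)))
        \<longlonglongrightarrow> snd c' + (information (fst l) - 0 * information c0) / (1 - 0)"
      by (intro tendsto_intros er J) auto
    then show "(\<lambda>n. snd c' + (information (d (r n)) - e (r n) * information c0) / (1 - e (r n)))
        \<longlonglongrightarrow> snd c' + information (fst l)"
      by simp
  qed (rule qlim)
  show thesis
  proof (rule that[of "\<lambda>n. d (r n)" "fst l" "\<lambda>x y. snd l $ (x, y)"])
    show "fst l \<in> C"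
      using l(1) by auto
    show "cross_entropy (\<lambda>x y. snd l $ (x, y)) (fst c') - snd c' \<le> information (fst l)"
      if "c' \<in> C" for c'
      using bound[OF that] by simp
  qed (use d lim qlim bound in auto)
qed

lemma convex_positive_marginals:
  fixes C :: "((real ^ ('x::finite \<times> 'y::finite)) \<times> real) set"
  assumes C: "convex C" "\<And>c. c \<in> C \<Longrightarrow> nonneg_vec (fst c)"
    and ex: "\<And>x. \<exists>c\<in>C. 0 < marginal (fst c) x"
  obtains c where "c \<in> C" "\<And>x. 0 < marginal (fst c) x"
proof -
  obtain f where f: "\<And>x. f x \<in> C" "\<And>x. 0 < marginal (fst (f x)) x"
    using ex by metis
  define a where "a = 1 / real CARD('x)"
  define c where "c = (\<Sum>x\<in>UNIV. a *\<^sub>R f x)"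
  have a: "0 < a"
    by (simp add: a_def)
  have "c \<in> C"
    unfolding c_def by (rule convex_sum[OF _ C(1)]) (use f a in \<open>auto simp: a_def\<close>)
  moreover have "0 < marginal (fst c) z" for z
  proof -
    have "marginal (fst c) z = (\<Sum>x\<in>UNIV. a * marginal (fst (f x)) z)"
      unfolding marginal_def joint_def c_def sum_distrib_left
      by (subst sum.swap) (simp add: fst_sum)
    moreover have "0 < (\<Sum>x\<in>UNIV. a * marginal (fst (f x)) z)"
      using a f marginal_nonneg[OF C(2)] by (intro sum_pos2[of _ z]) auto
    ultimately show ?thesis by simp
  qed
  ultimately show thesis
    by (rule that)
qed

section \<open>Convergent prior sequences\<close>

text \<open>An arbitrarily small admixture of \<open>ms n\<close> suffices to keep the limit of the conditionals: where
\<open>m\<close> has no mass the conditional of the mixture is exactly that of \<open>ms n\<close>, and elsewhere both limits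
are the conditional of \<open>m\<close>.\<close>

lemma conditional_mix_limit:
  fixes ms :: "nat \<Rightarrow> real ^ ('x::finite \<times> 'y::finite)"
  assumes m: "nonneg_vec m" and ms: "ms \<longlonglongrightarrow> m"
    and q: "(\<lambda>n. conditional (ms n) x y) \<longlonglongrightarrow> q"
    and u: "\<And>n. 0 < u n" "u \<longlonglongrightarrow> 0"
  shows "(\<lambda>n. conditional ((1 - u n) *\<^sub>R m + u n *\<^sub>R ms n) x y) \<longlonglongrightarrow> q"
proof (cases "marginal m x = 0")
  case True
  then have "joint m x y = 0"
    using joint_nonneg[OF m, of x y] joint_le_marginal[OF m, of x y] by simp
  then have "conditional ((1 - u n) *\<^sub>R m + u n *\<^sub>R ms n) x y = conditional (ms n) x y" for n
    using True u(1)[of n] by (simp add: conditional_def joint_mix marginal_mix)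
  then show ?thesis
    using q by simp
next
  case False
  have "(\<lambda>n. (1 - u n) *\<^sub>R m + u n *\<^sub>R ms n) \<longlonglongrightarrow> (1 - 0) *\<^sub>R m + 0 *\<^sub>R m"
    by (intro tendsto_intros u ms)
  then have "(\<lambda>n. conditional ((1 - u n) *\<^sub>R m + u n *\<^sub>R ms n) x y) \<longlonglongrightarrow> conditional m x y"
    using False by (intro tendsto_conditional) auto
  moreover have "conditional m x y = q"
    using LIMSEQ_unique[OF tendsto_conditional[OF ms False] q] .
  ultimately show ?thesis by simp
qed

text \<open>Convergence holds for any \<open>\<nu> n\<close> whatsoever, since integrals of a bounded function against
them stay bounded and receive weight \<open>u n\<close>.\<close>

lemma weakly_converges_mix_prior:
  assumes \<pi>: "\<pi> \<in> priors \<Theta>" "\<And>n. \<nu> n \<in> priors \<Theta>"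
    and u: "\<And>n. 0 \<le> u n" "\<And>n. u n \<le> 1" "u \<longlonglongrightarrow> 0"
  shows "weakly_converges \<Theta> (\<lambda>n. mix_prior (u n) \<pi> (\<nu> n)) \<pi>"
  unfolding weakly_converges_def
proof (intro allI impI, elim conjE)
  fix f :: "'a \<Rightarrow> real"
  assume f: "continuous_on \<Theta> f" "bounded (f ` \<Theta>)"
  obtain B where B: "\<forall>\<theta>\<in>\<Theta>. norm (f \<theta>) \<le> B"
    using f(2) by (auto simp: bounded_iff)
  have bd: "norm (\<integral>\<theta>. f \<theta> \<partial>\<nu> n) \<le> B" for n
  proof -
    interpret prob_space "\<nu> n" using \<pi>(2) by (simp add: priors_def)
    have ae: "AE \<theta> in \<nu> n. norm (f \<theta>) \<le> B"
      using B space_prior[OF \<pi>(2)] by (intro AE_I2) auto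
    then have "integrable (\<nu> n) f"
      by (intro integrable_const_bound[of _ B] prior_measurable[OF \<pi>(2) f(1)])
    then have "(\<integral>\<theta>. norm (f \<theta>) \<partial>\<nu> n) \<le> B"
      using ae by (intro integral_le_const) auto
    then show ?thesis
      using integral_norm_bound order_trans by blast
  qed
  have "(\<lambda>n. u n * (\<integral>\<theta>. f \<theta> \<partial>\<nu> n)) \<longlonglongrightarrow> 0"
    by (rule lim_null_mult_right_bounded[where B = B, OF u(3)]) (use bd in auto)
  then have "(\<lambda>n. (1 - u n) * (\<integral>\<theta>. f \<theta> \<partial>\<pi>) + u n * (\<integral>\<theta>. f \<theta> \<partial>\<nu> n))
      \<longlonglongrightarrow> (1 - 0) * (\<integral>\<theta>. f \<theta> \<partial>\<pi>) + 0"
    by (intro tendsto_intros u)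
  then show "(\<lambda>n. \<integral>\<theta>. f \<theta> \<partial>mix_prior (u n) \<pi> (\<nu> n)) \<longlonglongrightarrow> (\<integral>\<theta>. f \<theta> \<partial>\<pi>)"
    by (simp add: integral_mix_prior[OF \<pi> u(1,2) f])
qed

context compact_model
begin

text \<open>The priors are \<open>(1 - u n) \<pi> + u n \<nu> n\<close>, where \<open>\<pi>\<close> realises the limit point and \<open>\<nu> n\<close>
realises the points converging to it. Weak convergence is then immediate, although the
\<open>\<nu> n\<close> themselves need not converge.\<close>

lemma limit_of_bayes_minimax:
  assumes ex: "\<And>x. \<exists>\<theta>\<in>\<Theta>. 0 < marginal \<theta> x"
  obtains \<pi>s \<pi> q where "\<And>n. \<pi>s n \<in> priors \<Theta>" "\<pi> \<in> priors \<Theta>" "weakly_converges \<Theta> \<pi>s \<pi>"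
    "\<And>n x. 0 < mix_marginal (\<pi>s n) x" "\<And>x y. (\<lambda>n. bayes_predictive (\<pi>s n) x y) \<longlonglongrightarrow> q x y"
    "minimax \<Theta> q" "\<And>\<pi>'. \<pi>' \<in> priors \<Theta> \<Longrightarrow> cond_mutual_info \<pi>' \<le> cond_mutual_info \<pi>"
proof -
  let ?C = "moment_body \<Theta>"
  have C: "compact ?C" "convex ?C" "\<And>c. c \<in> ?C \<Longrightarrow> nonneg_vec (fst c)"
    using compact_moment_body[OF compact] convex_moment_body nonneg_moment_body by auto
  have ex': "\<exists>c\<in>?C. 0 < marginal (fst c) x" for x
  proof -
    obtain \<theta> where \<theta>: "\<theta> \<in> \<Theta>" "0 < marginal \<theta> x"
      using ex by blast
    then show ?thesis
      by (intro bexI[OF _ graph_point_in_moment_body[OF \<theta>(1)]]) simp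
  qed
  obtain c0 where c0: "c0 \<in> ?C" "\<And>x. 0 < marginal (fst c0) x"
    by (rule convex_positive_marginals[OF C(2,3) ex']) blast+
  obtain cs c q where cs: "\<And>n. cs n \<in> ?C" "\<And>n x. 0 < marginal (fst (cs n)) x" and c: "c \<in> ?C"
    and lim: "cs \<longlonglongrightarrow> c" "\<And>x y. (\<lambda>n. conditional (fst (cs n)) x y) \<longlonglongrightarrow> q x y"
    and q: "\<And>c'. c' \<in> ?C \<Longrightarrow> dominates q (fst c')"
      "\<And>c'. c' \<in> ?C \<Longrightarrow> cross_entropy q (fst c') - snd c' \<le> information c"
    by (rule limiting_maximizer[OF C c0]) blast+
  obtain \<pi> where \<pi>: "\<pi> \<in> priors \<Theta>" "moments \<pi> = c"
    by (rule moment_body_realised[OF c])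
  have "\<exists>\<nu>. \<nu> \<in> priors \<Theta> \<and> moments \<nu> = cs n" for n
    by (rule moment_body_realised[OF cs(1)[of n]]) blast+
  then obtain \<nu> where \<nu>: "\<And>n. \<nu> n \<in> priors \<Theta>" "\<And>n. moments (\<nu> n) = cs n"
    by metis
  have info: "cond_mutual_info \<pi> = information c"
    by (simp add: cond_mutual_info_eq[OF \<pi>(1)] information_def moments_def flip: \<pi>(2))
  define u where "u n = 1 / (real n + 2)" for n :: nat
  have u: "0 < u n" "u n < 1" for n
    by (auto simp: u_def field_simps)
  have u0: "u \<longlonglongrightarrow> 0"
    unfolding u_def by (rule weight_tendsto_0)
  define \<pi>s where "\<pi>s n = mix_prior (u n) \<pi> (\<nu> n)" for n
  have \<pi>s: "\<pi>s n \<in> priors \<Theta>" for n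
    unfolding \<pi>s_def by (intro mix_prior_in_priors \<pi> \<nu>)
  have "moments (\<pi>s n) = (1 - u n) *\<^sub>R c + u n *\<^sub>R cs n" for n
    using u[of n] unfolding \<pi>s_def by (simp add: moments_mix_prior \<pi> \<nu>)
  from arg_cong[OF this, of fst]
  have bary: "barycentre (\<pi>s n) = (1 - u n) *\<^sub>R fst c + u n *\<^sub>R fst (cs n)" for n
    by (simp add: moments_def)
  have pred: "predictive_density q"
    unfolding predictive_density_def
  proof (intro conjI allI)
    fix x y
    have "conditional (fst (cs n)) x y \<in> {0..1}" for n
      by (rule conditional_range[OF C(3)[OF cs(1)]])
    then show "q x y \<in> {0..1}"
      by (intro closed_sequentially[OF _ _ lim(2)]) auto
    have "(\<lambda>n. \<Sum>y\<in>UNIV. conditional (fst (cs n)) x y) \<longlonglongrightarrow> (\<Sum>y\<in>UNIV. q x y)"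
      by (intro tendsto_sum lim)
    moreover have "(\<Sum>y\<in>UNIV. conditional (fst (cs n)) x y) = 1" for n
      using cs(2)[of n x] by (intro sum_conditional) simp
    ultimately show "(\<Sum>y\<in>UNIV. q x y) = 1"
      by (simp add: LIMSEQ_const_iff)
  qed
  have risk: "kl_risk q \<theta> \<le> ereal (cond_mutual_info \<pi>)" if \<theta>: "\<theta> \<in> \<Theta>" for \<theta>
    using q[OF graph_point_in_moment_body[OF \<theta>]] pred
    by (subst kl_risk_eq[OF nonneg[OF \<theta>]]) (auto simp: info predictive_density_def)
  show thesis
  proof (rule that[OF \<pi>s \<pi>(1)])
    show "weakly_converges \<Theta> \<pi>s \<pi>"
      unfolding \<pi>s_def by (intro weakly_converges_mix_prior \<pi> \<nu> u0 less_imp_le u)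
    show "0 < mix_marginal (\<pi>s n) x" for n x
    proof -
      have "mix_marginal (\<pi>s n) x = (1 - u n) * marginal (fst c) x + u n * marginal (fst (cs n)) x"
        using marginal_barycentre[OF \<pi>s, of n x] by (simp add: bary marginal_mix)
      also have "0 < \<dots>"
        using u[of n] cs(2)[of n x] marginal_nonneg[OF C(3)[OF c], of x]
        by (intro add_nonneg_pos) auto
      finally show ?thesis .
    qed
    show "(\<lambda>n. bayes_predictive (\<pi>s n) x y) \<longlonglongrightarrow> q x y" for x y
      unfolding bayes_predictive_eq[OF \<pi>s] bary
      by (intro conditional_mix_limit C(3) c tendsto_fst lim u u0)
    show "minimax \<Theta> q"
      by (rule minimax_if_risk_le_information[OF \<pi>(1) pred risk])
    show "cond_mutual_info \<pi>' \<le> cond_mutual_info \<pi>" if "\<pi>' \<in> priors \<Theta>" for \<pi>'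
      by (rule cond_mutual_info_le[OF that pred risk])
  qed
qed

end

theorem theorem2:
  fixes \<Theta> :: "(real ^ ('x::finite \<times> 'y::finite)) set"
  assumes "\<Theta> \<subseteq> prob_simplex"
    and "compact \<Theta>"
    and "\<forall>x. \<exists>\<theta>\<in>\<Theta>. marginal \<theta> x > 0"
  shows "(\<exists>\<pi>s \<pi>_lim.
            (\<forall>n. \<pi>s n \<in> priors \<Theta>) \<and> \<pi>_lim \<in> priors \<Theta> \<and>
            weakly_converges \<Theta> \<pi>s \<pi>_lim \<and>
            (\<forall>n x. mix_marginal (\<pi>s n) x > 0) \<and>
            (\<forall>x y. convergent (\<lambda>n. bayes_predictive (\<pi>s n) x y)) \<and>
            minimax \<Theta> (\<lambda>x y. lim (\<lambda>n. bayes_predictive (\<pi>s n) x y)) \<and>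
            ereal (cond_mutual_info \<pi>_lim) = (SUP \<pi>\<in>priors \<Theta>. ereal (cond_mutual_info \<pi>)))
       \<and> (\<forall>\<pi>_hat\<in>priors \<Theta>.
            (\<forall>\<pi>\<in>priors \<Theta>. cond_mutual_info \<pi> \<le> cond_mutual_info \<pi>_hat) \<and>
            (\<forall>x. mix_marginal \<pi>_hat x > 0) \<longrightarrow>
            minimax \<Theta> (bayes_predictive \<pi>_hat))"
proof -
  have nonneg: "nonneg_vec \<theta>" if "\<theta> \<in> \<Theta>" for \<theta>
    using assms(1) that by (auto simp: prob_simplex_def nonneg_vec_def)
  interpret compact_model \<Theta>
    using assms(2) nonneg by unfold_locales
  have ex: "\<exists>\<theta>\<in>\<Theta>. 0 < marginal \<theta> x" for x
    using assms(3) by blast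
  obtain \<pi>s \<pi> q where *: "\<And>n. \<pi>s n \<in> priors \<Theta>" "\<pi> \<in> priors \<Theta>" "weakly_converges \<Theta> \<pi>s \<pi>"
    "\<And>n x. 0 < mix_marginal (\<pi>s n) x"
    and lim: "\<And>x y. (\<lambda>n. bayes_predictive (\<pi>s n) x y) \<longlonglongrightarrow> q x y"
    and q: "minimax \<Theta> q"
    and max: "\<And>\<pi>'. \<pi>' \<in> priors \<Theta> \<Longrightarrow> cond_mutual_info \<pi>' \<le> cond_mutual_info \<pi>"
    by (rule limit_of_bayes_minimax[OF ex]) blast+
  have "(\<lambda>x y. lim (\<lambda>n. bayes_predictive (\<pi>s n) x y)) = q"
    by (intro ext limI lim)
  moreover have "ereal (cond_mutual_info \<pi>) = (SUP \<pi>\<in>priors \<Theta>. ereal (cond_mutual_info \<pi>))"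
    using max *(2) by (auto intro!: antisym SUP_upper SUP_least)
  ultimately have "\<exists>\<pi>s \<pi>_lim.
      (\<forall>n. \<pi>s n \<in> priors \<Theta>) \<and> \<pi>_lim \<in> priors \<Theta> \<and>
      weakly_converges \<Theta> \<pi>s \<pi>_lim \<and>
      (\<forall>n x. mix_marginal (\<pi>s n) x > 0) \<and>
      (\<forall>x y. convergent (\<lambda>n. bayes_predictive (\<pi>s n) x y)) \<and>
      minimax \<Theta> (\<lambda>x y. lim (\<lambda>n. bayes_predictive (\<pi>s n) x y)) \<and>
      ereal (cond_mutual_info \<pi>_lim) = (SUP \<pi>\<in>priors \<Theta>. ereal (cond_mutual_info \<pi>))"
    using * q convergentI[OF lim] by (intro exI[of _ \<pi>s] exI[of _ \<pi>]) simp
  moreover have "\<forall>\<pi>_hat\<in>priors \<Theta>.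
      (\<forall>\<pi>\<in>priors \<Theta>. cond_mutual_info \<pi> \<le> cond_mutual_info \<pi>_hat) \<and>
      (\<forall>x. mix_marginal \<pi>_hat x > 0) \<longrightarrow> minimax \<Theta> (bayes_predictive \<pi>_hat)"
    by (intro ballI impI minimax_bayes_predictive) auto
  ultimately show ?thesis
    by (rule conjI)
qed

end
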